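(* Let $(\mathcal{C},F)$ be a generalized network code. For all $x_1,x_2\in\mathcal{C}$ with $x_1\neq x_2$, $$D_2(x_1,x_2)\ \ge\ \left\lceil \frac{D_0(x_1,x_2)}{2}\right\rceil .$$
   Context: A generalized network channel consists of a set $\mathcal{C}$ of codewords, a set $\mathcal{E}$ of errors with a distinguished element $0$ (the zero error), an output set $\mathcal{Y}$, a weight $w:\mathcal{E}\to\mathbb{Z}_{\ge 0}$ with $w(z)=0$ if and only if $z=0$, and a transfer function $F:\mathcal{C}\times\mathcal{E}\to\mathcal{Y}$ such that $F(x,0)\ne F(x',0)$ whenever $x\neq x'$ in $\mathcal{C}$. The sets are otherwise arbitrary. The pair $(\mathcal{C},F)$ is called a generalized network code; $|\mathcal{C}|\ge 2$ is assumed. For $x\in\mathcal{C}$ and an integer $c\ge 0$, the decoding ball is $\Phi(x,c)=\{F(x,z): z\in\mathcal{E},\ w(z)\le c\}$. For $x_1,x_2\in\mathcal{C}$ (all $c$'s are nonnegative integers, and a minimum over the empty set is $+\infty$, with $\lceil +\infty/2\rceil=+\infty$): $D_0(x_1,x_2)=\min\{c_1+c_2 : |c_1-c_2|\le 1,\ \Phi(x_1,c_1)\cap\Phi(x_2,c_2)\ne\emptyset\}$; $D_2(x_1,x_2)=\min\{c_1+c_2 : \Phi(x_1,c_1)\cap\Phi(x_2,c_2)\neq\emptyset\}$. *)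

theory Defs
  imports Complex_Main "HOL-Library.Extended_Nat"
begin

text \<open>The channel data are carriers \<open>C\<close>, \<open>E\<close>, \<open>Y\<close> (sets over arbitrary types, not assumed
  finite), the zero error \<open>e0\<close>, the weight \<open>w\<close>, and the curried transfer function \<open>F\<close>;
  \<open>w\<close> and \<open>F\<close> are constrained only on the carriers.\<close>

locale generalized_network_code =
  fixes C :: "'c set" and E :: "'e set" and e0 :: 'e and Y :: "'y set"
    and w :: "'e \<Rightarrow> nat" and F :: "'c \<Rightarrow> 'e \<Rightarrow> 'y"
  assumes zero_error: "e0 \<in> E"
    and weight_eq_0_iff: "\<And>z. z \<in> E \<Longrightarrow> w z = 0 \<longleftrightarrow> z = e0"
    and transfer_closed: "\<And>x z. x \<in> C \<Longrightarrow> z \<in> E \<Longrightarrow> F x z \<in> Y"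
    and transfer_inj: "\<And>x x'. x \<in> C \<Longrightarrow> x' \<in> C \<Longrightarrow> x \<noteq> x' \<Longrightarrow> F x e0 \<noteq> F x' e0"
    and two_codewords: "\<exists>x\<in>C. \<exists>x'\<in>C. x \<noteq> x'"

definition decoding_ball :: "'e set \<Rightarrow> ('e \<Rightarrow> nat) \<Rightarrow> ('c \<Rightarrow> 'e \<Rightarrow> 'y) \<Rightarrow> 'c \<Rightarrow> nat \<Rightarrow> 'y set" where
  "decoding_ball E w F x c = {F x z | z. z \<in> E \<and> w z \<le> c}"

text \<open>In \<^typ>\<open>enat\<close> the infimum of a nonempty set is its minimum, and the infimum of the
  empty set is \<open>\<infinity>\<close>.\<close>

definition D0 :: "'e set \<Rightarrow> ('e \<Rightarrow> nat) \<Rightarrow> ('c \<Rightarrow> 'e \<Rightarrow> 'y) \<Rightarrow> 'c \<Rightarrow> 'c \<Rightarrow> enat" where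
  "D0 E w F x1 x2 = Inf {enat (c1 + c2) | c1 c2. \<bar>int c1 - int c2\<bar> \<le> 1 \<and>
     decoding_ball E w F x1 c1 \<inter> decoding_ball E w F x2 c2 \<noteq> {}}"

definition D2 :: "'e set \<Rightarrow> ('e \<Rightarrow> nat) \<Rightarrow> ('c \<Rightarrow> 'e \<Rightarrow> 'y) \<Rightarrow> 'c \<Rightarrow> 'c \<Rightarrow> enat" where
  "D2 E w F x1 x2 = Inf {enat (c1 + c2) | c1 c2.
     decoding_ball E w F x1 c1 \<inter> decoding_ball E w F x2 c2 \<noteq> {}}"

definition ceil_half :: "enat \<Rightarrow> enat" where
  "ceil_half d = (case d of enat n \<Rightarrow> enat (nat \<lceil>real n / 2\<rceil>) | \<infinity> \<Rightarrow> \<infinity>)"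

end

theory Submission
  imports Defs
begin

text \<open>If the balls of radii \<open>c1\<close> and \<open>c2\<close> meet, then so do the two balls of the common
  radius \<open>max c1 c2\<close>. These radii are balanced, so \<open>D0 \<le> 2 * max c1 c2 \<le> 2 * (c1 + c2)\<close>.\<close>

lemma decoding_ball_mono:
  assumes "c \<le> c'"
  shows "decoding_ball E w F x c \<subseteq> decoding_ball E w F x c'"
  using assms unfolding decoding_ball_def by fastforce

lemma D0_le:
  assumes "\<bar>int c1 - int c2\<bar> \<le> 1"
    and "decoding_ball E w F x1 c1 \<inter> decoding_ball E w F x2 c2 \<noteq> {}"
  shows "D0 E w F x1 x2 \<le> enat (c1 + c2)"
  unfolding D0_def by (rule Inf_lower) (use assms in blast)

text \<open>Rounding up costs nothing here: a ceiling is bounded by the integer \<open>n\<close> as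
  soon as the real number \<open>m / 2\<close> is.\<close>

lemma ceil_half_le:
  assumes "d \<le> enat (2 * n)"
  shows "ceil_half d \<le> enat n"
proof (cases d)
  case (enat m)
  then have "real m / 2 \<le> real n"
    using assms by simp
  then have "\<lceil>real m / 2\<rceil> \<le> int n"
    by (simp add: ceiling_le_iff)
  then have "nat \<lceil>real m / 2\<rceil> \<le> n"
    by (simp only: nat_le_iff)
  then show ?thesis
    by (simp only: enat ceil_half_def enat.case enat_ord_simps)
\<comment> \<open>The remaining case \<open>d = \<infinity>\<close> contradicts the finite bound on
  \<open>d\<close>.\<close>
qed (use assms in simp)

theorem theorem5p7:
  fixes C :: "'c set" and E :: "'e set" and e0 :: 'e and Y :: "'y set"
    and w :: "'e \<Rightarrow> nat" and F :: "'c \<Rightarrow> 'e \<Rightarrow> 'y" and x1 x2 :: 'c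
  assumes "generalized_network_code C E e0 Y w F"
    and "x1 \<in> C" and "x2 \<in> C" and "x1 \<noteq> x2"
  shows "D2 E w F x1 x2 \<ge> ceil_half (D0 E w F x1 x2)"
proof -
  have "ceil_half (D0 E w F x1 x2) \<le> enat (c1 + c2)"
    if meet: "decoding_ball E w F x1 c1 \<inter> decoding_ball E w F x2 c2 \<noteq> {}" for c1 c2
  proof (rule ceil_half_le)
    let ?m = "max c1 c2"
    have "decoding_ball E w F x1 ?m \<inter> decoding_ball E w F x2 ?m \<noteq> {}"
      using meet decoding_ball_mono[of c1 ?m E w F x1] decoding_ball_mono[of c2 ?m E w F x2]
      by auto
    then have "D0 E w F x1 x2 \<le> enat (?m + ?m)"
      by (intro D0_le) simp_all
    \<comment> \<open>The maximum of two naturals is at most their sum; the factor 2 is what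
      \<open>ceil_half\<close> absorbs.\<close>
    also have "\<dots> \<le> enat (2 * (c1 + c2))"
      by simp
    finally show "D0 E w F x1 x2 \<le> enat (2 * (c1 + c2))" .
  qed
  \<comment> \<open>A lower bound for every admissible sum bounds the infimum. This includes the
    case where no balls meet and \<open>D2\<close> is \<open>\<infinity>\<close>.\<close>
  then show ?thesis
    unfolding D2_def by (auto intro!: Inf_greatest)
qed

end
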